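(* Let $f : B(\Omega,\mathcal{A})\rightarrow\mathbb{R}$ be a pricing rule. Then: (i) If $f$ is a Choquet pricing rule with respect to a capacity $v$, then $f$ is arbitrage free (AF) if and only if $AC(v)\neq\emptyset$. (ii) If $f$ is a Šipoš pricing rule, then $f$ is arbitrage free (AF) if and only if $f$ is linear.
   Context: $\Omega$ is a set (finite or infinite) endowed with a $\sigma$-algebra $\mathcal{A}$, and $B(\Omega,\mathcal{A})$ is the set of all bounded, $\mathcal{A}$-measurable functions $x:\Omega\to\mathbb{R}$, with pointwise operations and pointwise order. For $x\in B(\Omega,\mathcal{A})$, $x^+ := x\vee 0$ and $x^-:=(-x)\vee 0$. A pricing rule is a function $f:B(\Omega,\mathcal{A})\to\mathbb{R}$ that is not identically zero. It is linear if $f(\alpha x+\beta x')=\alpha f(x)+\beta f(x')$ for all $x,x'\in B(\Omega,\mathcal{A})$, $\alpha,\beta\in\mathbb{R}$. $f$ is arbitrage free (AF) if for all $n\in\mathbb{N}$ and all $x_1,\dots,x_n\in B(\Omega,\mathcal{A})$, $\sum_{i=1}^n x_i\ge 0$ implies $\sum_{i=1}^n f(x_i)\ge 0$. A capacity on $(\Omega,\mathcal{A})$ is a set function $v:\mathcal{A}\to\mathbb{R}$ with $v(\emptyset)=0$ and $v(A)\le v(B)$ whenever $A\subseteq B$, $A,B\in\mathcal{A}$. The Choquet integral of $x\in B(\Omega,\mathcal{A})$ with respect to $v$ is $$\int^C x\,dv:=\int_{-\infty}^0\big(v(\{x\geq t\})-v(\Omega)\big)\,dt + \int_0^{+\infty}v(\{x\geq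 t\})\,dt ,$$ and the Šipoš integral is $\int^S x\,dv:=\int^C x^+\,dv-\int^C x^-\,dv$. $f$ is a Choquet (resp. Šipoš) pricing rule with respect to the capacity $v$ if $f(x)=\int^C x\,dv$ (resp. $f(x)=\int^S x\,dv$) for all $x\in B(\Omega,\mathcal{A})$; it is a Šipoš pricing rule if this holds for some capacity $v$. The anticore of a capacity $v$ is $$AC(v)=\{\mu:\mathcal{A}\to\mathbb{R}_+ \,:\, \mu \text{ is (finitely) additive},\ \mu(A)\le v(A)\ \text{for all } A\in\mathcal{A},\ \mu(\Omega)=v(\Omega)\},$$ where $\mu$ is additive if $\mu(A\cup B)=\mu(A)+\mu(B)$ whenever $A\cap B=\emptyset$, $A,B\in\mathcal{A}$. *)

theory Defs
  imports "HOL-Analysis.Analysis"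
begin

text \<open>
  A function on \<open>\<Omega>\<close> is represented by the function on the ambient type that extends it by zero, so
  that distinct members of \<open>bounded_measurable \<Omega> \<A>\<close> differ on \<open>\<Omega>\<close>, and the set is closed under
  the plain pointwise operations. A functional on \<open>bounded_measurable \<Omega> \<A>\<close> and a set function on \<open>\<A>\<close>
  are total HOL functions whose values elsewhere are never used.
\<close>

definition bounded_measurable :: "'a set \<Rightarrow> 'a set set \<Rightarrow> ('a \<Rightarrow> real) set" where
  "bounded_measurable \<Omega> \<A> =
    {x. x \<in> borel_measurable (sigma \<Omega> \<A>) \<and> bounded (x ` \<Omega>) \<and> (\<forall>\<omega>. \<omega> \<notin> \<Omega> \<longrightarrow> x \<omega> = 0)}"

definition pricing_rule :: "'a set \<Rightarrow> 'a set set \<Rightarrow> (('a \<Rightarrow> real) \<Rightarrow> real) \<Rightarrow> bool" where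
  "pricing_rule \<Omega> \<A> f \<longleftrightarrow> (\<exists>x \<in> bounded_measurable \<Omega> \<A>. f x \<noteq> 0)"

definition linear_rule :: "'a set \<Rightarrow> 'a set set \<Rightarrow> (('a \<Rightarrow> real) \<Rightarrow> real) \<Rightarrow> bool" where
  "linear_rule \<Omega> \<A> f \<longleftrightarrow>
    (\<forall>x \<in> bounded_measurable \<Omega> \<A>. \<forall>x' \<in> bounded_measurable \<Omega> \<A>. \<forall>\<alpha> \<beta> :: real.
      f (\<lambda>\<omega>. \<alpha> * x \<omega> + \<beta> * x' \<omega>) = \<alpha> * f x + \<beta> * f x')"

definition arbitrage_free :: "'a set \<Rightarrow> 'a set set \<Rightarrow> (('a \<Rightarrow> real) \<Rightarrow> real) \<Rightarrow> bool" where
  "arbitrage_free \<Omega> \<A> f \<longleftrightarrow>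
    (\<forall>(n::nat) (x :: nat \<Rightarrow> 'a \<Rightarrow> real).
      (\<forall>i \<in> {1..n}. x i \<in> bounded_measurable \<Omega> \<A>) \<longrightarrow>
      (\<forall>\<omega> \<in> \<Omega>. 0 \<le> (\<Sum>i = 1..n. x i \<omega>)) \<longrightarrow>
      0 \<le> (\<Sum>i = 1..n. f (x i)))"

definition capacity :: "'a set set \<Rightarrow> ('a set \<Rightarrow> real) \<Rightarrow> bool" where
  "capacity \<A> v \<longleftrightarrow> v {} = 0 \<and> (\<forall>A \<in> \<A>. \<forall>B \<in> \<A>. A \<subseteq> B \<longrightarrow> v A \<le> v B)"

definition choquet_integral :: "'a set \<Rightarrow> ('a set \<Rightarrow> real) \<Rightarrow> ('a \<Rightarrow> real) \<Rightarrow> real" where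
  "choquet_integral \<Omega> v x =
    (LBINT t=-\<infinity>..0. v {\<omega> \<in> \<Omega>. t \<le> x \<omega>} - v \<Omega>) + (LBINT t=0..\<infinity>. v {\<omega> \<in> \<Omega>. t \<le> x \<omega>})"

definition sipos_integral :: "'a set \<Rightarrow> ('a set \<Rightarrow> real) \<Rightarrow> ('a \<Rightarrow> real) \<Rightarrow> real" where
  "sipos_integral \<Omega> v x =
    choquet_integral \<Omega> v (\<lambda>\<omega>. max (x \<omega>) 0) - choquet_integral \<Omega> v (\<lambda>\<omega>. max (- x \<omega>) 0)"

definition choquet_pricing_rule ::
    "'a set \<Rightarrow> 'a set set \<Rightarrow> ('a set \<Rightarrow> real) \<Rightarrow> (('a \<Rightarrow> real) \<Rightarrow> real) \<Rightarrow> bool" where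
  "choquet_pricing_rule \<Omega> \<A> v f \<longleftrightarrow>
    (\<forall>x \<in> bounded_measurable \<Omega> \<A>. f x = choquet_integral \<Omega> v x)"

definition sipos_pricing_rule :: "'a set \<Rightarrow> 'a set set \<Rightarrow> (('a \<Rightarrow> real) \<Rightarrow> real) \<Rightarrow> bool" where
  "sipos_pricing_rule \<Omega> \<A> f \<longleftrightarrow>
    (\<exists>v. capacity \<A> v \<and> (\<forall>x \<in> bounded_measurable \<Omega> \<A>. f x = sipos_integral \<Omega> v x))"

definition anticore :: "'a set \<Rightarrow> 'a set set \<Rightarrow> ('a set \<Rightarrow> real) \<Rightarrow> ('a set \<Rightarrow> real) set" where
  "anticore \<Omega> \<A> v =
    {\<mu>. (\<forall>A \<in> \<A>. 0 \<le> \<mu> A) \<and> additive \<A> \<mu> \<and> (\<forall>A \<in> \<A>. \<mu> A \<le> v A) \<and> \<mu> \<Omega> = v \<Omega>}"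

end

theory Submission
  imports Defs
begin

text \<open>
  A linear functional below \<open>f\<close> that is monotone restricts to a charge in the anticore, and if \<open>f\<close> is
  arbitrage free then the superhedging price, the least total price of a finite family dominating a
  claim, is finite and sublinear, so Hahn-Banach provides such a functional. Conversely, given
  \<open>\<mu>\<close> in the anticore, the Choquet integral of \<open>x\<close> is at least \<open>1/N\<close> times the \<open>\<mu>\<close>-integral of the
  integer part of \<open>N x\<close>; such integrals of simple functions add up, and the rounding error
  vanishes as \<open>N\<close> grows. For the Sipos integral, which is odd and homogeneous, applying arbitrage
  freeness to \<open>x, y, -(x + y)\<close> and to their negatives gives additivity.
\<close>

section \<open>The Choquet integral\<close>

text \<open>Both pairs of endpoints are increasing, so no sign enters and the interval integrals
  become set integrals over open half-lines, the form in which the computations below are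
  done.\<close>

lemma choquet_integral_eq:
  "choquet_integral \<Omega> v x =
    (LINT t:{..<0}|lborel. v {\<omega> \<in> \<Omega>. t \<le> x \<omega>} - v \<Omega>) +
    (LINT t:{0<..}|lborel. v {\<omega> \<in> \<Omega>. t \<le> x \<omega>})"
  by (simp add: choquet_integral_def interval_lebesgue_integral_def zero_ereal_def)

lemma choquet_integral_cong:
  assumes "\<And>\<omega>. \<omega> \<in> \<Omega> \<Longrightarrow> x \<omega> = y \<omega>"
  shows "choquet_integral \<Omega> v x = choquet_integral \<Omega> v y"
proof -
  have "{\<omega> \<in> \<Omega>. t \<le> x \<omega>} = {\<omega> \<in> \<Omega>. t \<le> y \<omega>}" for t
    using assms by auto
  then show ?thesis by (simp add: choquet_integral_eq)
qed

lemma choquet_integral_zero: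
  assumes "v {} = 0"
  shows "choquet_integral \<Omega> v (\<lambda>\<omega>. 0) = 0"
proof -
  have "(LINT t:{..<0::real}|lborel. v {\<omega> \<in> \<Omega>. t \<le> 0} - v \<Omega>) = (LINT t:{..<0::real}|lborel. 0)"
    by (intro set_lebesgue_integral_cong) auto
  moreover have "(LINT t:{0<..}|lborel. v {\<omega> \<in> \<Omega>. t \<le> (0::real)}) = (LINT t:{0::real<..}|lborel. 0)"
    using assms by (intro set_lebesgue_integral_cong) auto
  ultimately show ?thesis
    by (simp add: choquet_integral_eq)
qed

lemma choquet_integral_nonneg:
  assumes "capacity \<A> v" "sigma_algebra \<Omega> \<A>" "\<And>t. {\<omega> \<in> \<Omega>. t \<le> x \<omega>} \<in> \<A>"
    and "\<And>\<omega>. \<omega> \<in> \<Omega> \<Longrightarrow> 0 \<le> x \<omega>"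
  shows "0 \<le> choquet_integral \<Omega> v x"
proof -
  interpret sigma_algebra \<Omega> \<A> by fact
  have "(LINT t:{..<0}|lborel. v {\<omega> \<in> \<Omega>. t \<le> x \<omega>} - v \<Omega>) = (LINT t:{..<0::real}|lborel. 0)"
  proof (intro set_lebesgue_integral_cong)
    show "\<forall>t. t \<in> {..<0} \<longrightarrow> v {\<omega> \<in> \<Omega>. t \<le> x \<omega>} - v \<Omega> = 0"
    proof (intro allI impI)
      fix t :: real assume "t \<in> {..<0}"
      then have "{\<omega> \<in> \<Omega>. t \<le> x \<omega>} = \<Omega>"
        using assms(4) by force
      then show "v {\<omega> \<in> \<Omega>. t \<le> x \<omega>} - v \<Omega> = 0" by simp
    qed
  qed auto
  moreover have "0 \<le> v {\<omega> \<in> \<Omega>. t \<le> x \<omega>}" for t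
    using assms(1) assms(3)[of t] unfolding capacity_def by (metis empty_sets empty_subsetI)
  \<comment> \<open>Positivity of the integrand suffices: a non-integrable function has Bochner
    integral 0, so the bound survives in that case too.\<close>
  then have "0 \<le> (LINT t:{0<..}|lborel. v {\<omega> \<in> \<Omega>. t \<le> x \<omega>})"
    unfolding set_lebesgue_integral_def by (intro Bochner_Integration.integral_nonneg) auto
  ultimately show ?thesis
    by (simp add: choquet_integral_eq)
qed

text \<open>The substitution t = c * s maps each half-line onto itself and carries the level sets of
  the scaled function to those of \<open>x\<close>; the Jacobian is the factor
  \<open>c\<close>.\<close>

lemma choquet_integral_pos_homogeneous:
  assumes "0 < c"
  shows "choquet_integral \<Omega> v (\<lambda>\<omega>. c * x \<omega>) = c * choquet_integral \<Omega> v x"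
proof -
  have level: "{\<omega> \<in> \<Omega>. c * t \<le> c * x \<omega>} = {\<omega> \<in> \<Omega>. t \<le> x \<omega>}" for t
    using assms by auto
  have ind: "indicator {..<0} (t * c) = (indicator {..<0} t :: real)"
    "indicator {0<..} (t * c) = (indicator {0<..} t :: real)" for t
    using assms by (auto simp: indicator_def mult_less_0_iff zero_less_mult_iff)
  show ?thesis
    unfolding choquet_integral_eq set_lebesgue_integral_def
    using assms
    by (subst (1 2) lborel_integral_real_affine[where c = c and t = 0])
      (simp_all add: level ind algebra_simps)
qed

lemma choquet_integral_homogeneous:
  assumes "0 \<le> c" "v {} = 0"
  shows "choquet_integral \<Omega> v (\<lambda>\<omega>. c * x \<omega>) = c * choquet_integral \<Omega> v x"
  using assms choquet_integral_pos_homogeneous[of c \<Omega> v x] choquet_integral_zero[of v \<Omega>]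
  by (cases "c = 0") auto

section \<open>Lower sums of decreasing functions and of the Choquet integral\<close>

lemma set_integrable_antimono:
  fixes g :: "real \<Rightarrow> real"
  assumes "antimono g"
  shows "set_integrable lborel {a<..b} g"
  unfolding set_integrable_def
proof (rule integrableI_bounded_set_indicator)
  have "mono (\<lambda>t. - g t)"
    using assms by (auto simp: mono_def antimono_def)
  then have "(\<lambda>t. - (- g t)) \<in> borel_measurable borel"
    by (intro borel_measurable_uminus borel_measurable_mono)
  then show "g \<in> borel_measurable lborel" by simp
  have "norm (g t) \<le> max \<bar>g a\<bar> \<bar>g b\<bar>" if "t \<in> {a<..b}" for t
    using that antimonoD[OF assms, of a t] antimonoD[OF assms, of t b] by auto
  then show "AE t in lborel. t \<in> {a<..b} \<longrightarrow> norm (g t) \<le> max \<bar>g a\<bar> \<bar>g b\<bar>"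
    by auto
  show "emeasure lborel {a<..b} < \<infinity>"
    by (cases "a \<le> b") auto
qed auto

text \<open>On each half-open unit interval a decreasing function is least at the right endpoint, so
  the left side is a lower Darboux sum of mesh one.\<close>

lemma lower_sum_le_integral_antimono:
  fixes g :: "real \<Rightarrow> real"
  assumes "antimono g"
  shows "(\<Sum>k = 1..n. g (a + real k)) \<le> (LINT t:{a<..a + real n}|lborel. g t)"
proof (induction n)
  case (Suc n)
  let ?A = "{a<..a + real n}" and ?B = "{a + real n<..a + real (Suc n)}"
  have "g (a + real (Suc n)) = (LINT t:?B|lborel. g (a + real (Suc n)))"
    by (simp add: set_lebesgue_integral_def)
  also have "\<dots> \<le> (LINT t:?B|lborel. g t)"
    using assms
    by (intro set_integral_mono set_integrable_antimono) (auto simp: antimono_def)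
  finally have "(\<Sum>k = 1..Suc n. g (a + real k)) \<le> (LINT t:?A|lborel. g t) + (LINT t:?B|lborel. g t)"
    using Suc by simp
  also have "\<dots> = (LINT t:?A \<union> ?B|lborel. g t)"
    using assms by (intro set_integral_Un[symmetric] set_integrable_antimono) auto
  also have "?A \<union> ?B = {a<..a + real (Suc n)}"
    by auto
  finally show ?case .
qed (simp add: set_lebesgue_integral_def)

text \<open>Scaling by a large factor makes this lower bound by unit steps asymptotically sharp.\<close>
lemma choquet_integral_ge_lower_sum:
  assumes "capacity \<A> v" "sigma_algebra \<Omega> \<A>" "\<And>t. {\<omega> \<in> \<Omega>. t \<le> x \<omega>} \<in> \<A>"
    and bound: "\<And>\<omega>. \<omega> \<in> \<Omega> \<Longrightarrow> \<bar>x \<omega>\<bar> \<le> real K"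
  shows "(\<Sum>k = 1..2 * K. v {\<omega> \<in> \<Omega>. real k - real K \<le> x \<omega>}) - real K * v \<Omega> \<le> choquet_integral \<Omega> v x"
proof -
  let ?g = "\<lambda>t. v {\<omega> \<in> \<Omega>. t \<le> x \<omega>}"
  have anti: "antimono ?g"
    using assms(1,3) unfolding capacity_def antimono_def
    by (smt (verit, best) Collect_mono)
  then have anti': "antimono (\<lambda>t. ?g t - v \<Omega>)"
    by (auto simp: antimono_def)
  \<comment> \<open>Outside [-K, K] both integrands vanish, so the integrals reduce to bounded
    intervals, where a decreasing function is integrable.\<close>
  have empty: "?g t = 0" if "t > real K" for t
  proof -
    have "{\<omega> \<in> \<Omega>. t \<le> x \<omega>} = {}" using that bound by force
    then show ?thesis using assms(1) unfolding capacity_def by metis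
  qed
  have full: "?g t = v \<Omega>" if "t \<le> - real K" for t
  proof -
    have "{\<omega> \<in> \<Omega>. t \<le> x \<omega>} = \<Omega>" using that bound by force
    then show ?thesis by simp
  qed
  \<comment> \<open>The half-open interval contains 0 and the open half-line does not; the
    integrands agree at every other point, hence almost everywhere.\<close>
  have "(LINT t:{..<0}|lborel. ?g t - v \<Omega>) = (LINT t:{- real K<..0}|lborel. ?g t - v \<Omega>)"
    unfolding set_lebesgue_integral_def
  proof (rule integral_cong_AE)
    have m: "(\<lambda>t. ?g t - v \<Omega>) \<in> borel_measurable lborel"
    proof -
      have "mono (\<lambda>t. - (?g t - v \<Omega>))"
        using anti' by (auto simp: mono_def antimono_def)
      then have "(\<lambda>t. - (- (?g t - v \<Omega>))) \<in> borel_measurable borel"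
        by (intro borel_measurable_uminus borel_measurable_mono)
      then show ?thesis by simp
    qed
    show "(\<lambda>t. indicator {..<0} t *\<^sub>R (?g t - v \<Omega>)) \<in> borel_measurable lborel"
      "(\<lambda>t. indicator {- real K<..0} t *\<^sub>R (?g t - v \<Omega>)) \<in> borel_measurable lborel"
      using m by (intro borel_measurable_scaleR borel_measurable_indicator, auto)+
    have *: "indicator {..<0} t *\<^sub>R (?g t - v \<Omega>) = indicator {- real K<..0} t *\<^sub>R (?g t - v \<Omega>)"
      if "t \<noteq> 0" for t
      using that full[of t] by (auto simp: indicator_def)
    show "AE t in lborel. indicator {..<0} t *\<^sub>R (?g t - v \<Omega>) = indicator {- real K<..0} t *\<^sub>R (?g t - v \<Omega>)"
      using AE_lborel_singleton[of 0] by eventually_elim (rule *)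
  qed
  moreover have "(LINT t:{0<..}|lborel. ?g t) = (LINT t:{0<..real K}|lborel. ?g t)"
    unfolding set_lebesgue_integral_def
    by (intro Bochner_Integration.integral_cong refl) (use empty in \<open>auto simp: indicator_def\<close>)
  moreover have "(\<Sum>k = 1..K. ?g (- real K + real k) - v \<Omega>) \<le> (LINT t:{- real K<..0}|lborel. ?g t - v \<Omega>)"
    using lower_sum_le_integral_antimono[OF anti', of "- real K" K] by simp
  moreover have "(\<Sum>k = 1..K. ?g (real k)) \<le> (LINT t:{0<..real K}|lborel. ?g t)"
    using lower_sum_le_integral_antimono[OF anti, of 0 K] by simp
  \<comment> \<open>The first K levels k - K are the steps of the negative half-line, the last K
    those of the positive one. Subtracting \<open>v \<Omega>\<close> in each of the first K steps
    accounts for the correction term of the claim.\<close>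
  moreover have "(\<Sum>k = 1..2 * K. ?g (real k - real K)) =
      (\<Sum>k = 1..K. ?g (- real K + real k)) + (\<Sum>k = 1..K. ?g (real k))"
  proof -
    have "{1..2 * K} = {1..K} \<union> {1 + K..K + K}" by auto
    then have "(\<Sum>k = 1..2 * K. ?g (real k - real K)) =
        (\<Sum>k = 1..K. ?g (real k - real K)) + (\<Sum>k = 1 + K..K + K. ?g (real k - real K))"
      by (simp only:) (subst sum.union_disjoint, auto)
    then show ?thesis
      by (simp only: sum.shift_bounds_cl_nat_ivl) simp
  qed
  ultimately show ?thesis
    unfolding choquet_integral_eq by (simp add: sum_subtractf)
qed

section \<open>Choquet integrals of indicators and of the constant -1\<close>

lemma choquet_integral_indicator:
  assumes "v {} = 0" "A \<subseteq> \<Omega>"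
  shows "choquet_integral \<Omega> v (indicator A) = v A"
proof -
  have "(LINT t:{..<0::real}|lborel. v {\<omega> \<in> \<Omega>. t \<le> indicator A \<omega>} - v \<Omega>) = (LINT t:{..<0::real}|lborel. 0)"
  proof (intro set_lebesgue_integral_cong allI impI)
    fix t :: real assume "t \<in> {..<0}"
    then have "{\<omega> \<in> \<Omega>. t \<le> indicator A \<omega>} = \<Omega>" by (auto simp: indicator_def)
    then show "v {\<omega> \<in> \<Omega>. t \<le> indicator A \<omega>} - v \<Omega> = 0" by simp
  qed auto
  moreover have "(LINT t:{0::real<..}|lborel. v {\<omega> \<in> \<Omega>. t \<le> indicator A \<omega>}) = (LINT t:{0<..1::real}|lborel. v A)"
    unfolding set_lebesgue_integral_def
  proof (intro Bochner_Integration.integral_cong refl)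
    fix t :: real
    have "{\<omega> \<in> \<Omega>. t \<le> indicator A \<omega>} = (if t \<le> 1 then A else {})" if "t > 0"
      using that assms by (auto simp: indicator_def split: if_splits)
    then show "indicator {0<..} t *\<^sub>R v {\<omega> \<in> \<Omega>. t \<le> indicator A \<omega>} = indicator {0<..1} t *\<^sub>R v A"
      using assms by (auto simp: indicator_def)
  qed
  ultimately show ?thesis
    by (simp add: choquet_integral_eq set_lebesgue_integral_def)
qed

text \<open>The level set is all of \<Omega> up to t = -1 and empty above, so the first integrand is
  \<open>- v \<Omega>\<close> exactly on the interval from -1 to 0. This price later forces the
  dominated charge to have full mass.\<close>

lemma choquet_integral_neg_one:
  assumes "v {} = 0"
  shows "choquet_integral \<Omega> v (\<lambda>\<omega>. - indicator \<Omega> \<omega>) = - v \<Omega>"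
proof -
  have "(LINT t:{..<0::real}|lborel. v {\<omega> \<in> \<Omega>. t \<le> - indicator \<Omega> \<omega>} - v \<Omega>) = (LINT t:{-1<..<0::real}|lborel. - v \<Omega>)"
    unfolding set_lebesgue_integral_def
  proof (intro Bochner_Integration.integral_cong refl)
    fix t :: real
    have "{\<omega> \<in> \<Omega>. t \<le> - indicator \<Omega> \<omega>} = (if t \<le> -1 then \<Omega> else {})"
      by (auto simp: indicator_def)
    then show "indicator {..<0} t *\<^sub>R (v {\<omega> \<in> \<Omega>. t \<le> - indicator \<Omega> \<omega>} - v \<Omega>) = indicator {-1<..<0} t *\<^sub>R - v \<Omega>"
      using assms by (auto simp: indicator_def)
  qed
  moreover have "(LINT t:{0::real<..}|lborel. v {\<omega> \<in> \<Omega>. t \<le> - indicator \<Omega> \<omega>}) = (LINT t:{0::real<..}|lborel. (0::real))"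
  proof (intro set_lebesgue_integral_cong allI impI)
    fix t :: real assume "t \<in> {0<..}"
    then have "{\<omega> \<in> \<Omega>. t \<le> - indicator \<Omega> \<omega>} = {}" by (auto simp: indicator_def)
    then show "v {\<omega> \<in> \<Omega>. t \<le> - indicator \<Omega> \<omega>} = 0" using assms by metis
  qed auto
  ultimately show ?thesis
    by (simp add: choquet_integral_eq set_lebesgue_integral_def)
qed

section \<open>Sublinear functionals on function spaces\<close>

definition linear_function_space :: "('a \<Rightarrow> real) set \<Rightarrow> bool" where
  "linear_function_space B \<longleftrightarrow> B \<noteq> {} \<and>
    (\<forall>x \<in> B. \<forall>y \<in> B. \<forall>a b. (\<lambda>\<omega>. a * x \<omega> + b * y \<omega>) \<in> B)"

text \<open>The inequality for positive factors encodes positive homogeneity: the factor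
  \<open>1 / c\<close> supplies the converse, and the value 0 at the zero function then follows from
  the factor 2.\<close>

definition sublinear_on :: "('a \<Rightarrow> real) set \<Rightarrow> (('a \<Rightarrow> real) \<Rightarrow> real) \<Rightarrow> bool" where
  "sublinear_on B p \<longleftrightarrow>
    (\<forall>x \<in> B. \<forall>y \<in> B. p (\<lambda>\<omega>. x \<omega> + y \<omega>) \<le> p x + p y) \<and>
    (\<forall>x \<in> B. \<forall>c > 0. p (\<lambda>\<omega>. c * x \<omega>) \<le> c * p x)"

context
  fixes B :: "('a \<Rightarrow> real) set"
  assumes B: "linear_function_space B"
begin

lemma function_space_lin_comb: "x \<in> B \<Longrightarrow> y \<in> B \<Longrightarrow> (\<lambda>\<omega>. a * x \<omega> + b * y \<omega>) \<in> B"
  using B unfolding linear_function_space_def by blast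

lemma function_space_add: "x \<in> B \<Longrightarrow> y \<in> B \<Longrightarrow> (\<lambda>\<omega>. x \<omega> + y \<omega>) \<in> B"
  using function_space_lin_comb[of x y 1 1] by simp

lemma function_space_scale: "x \<in> B \<Longrightarrow> (\<lambda>\<omega>. a * x \<omega>) \<in> B"
  using function_space_lin_comb[of x x a 0] by simp

lemma function_space_neg: "x \<in> B \<Longrightarrow> (\<lambda>\<omega>. - x \<omega>) \<in> B"
  using function_space_scale[of x "-1"] by simp

lemma function_space_zero: "(\<lambda>\<omega>. 0) \<in> B"
proof -
  obtain x where "x \<in> B" using B unfolding linear_function_space_def by blast
  then show ?thesis using function_space_scale[of x 0] by simp
qed

context
  fixes p
  assumes p: "sublinear_on B p"
begin

lemma sublinear_add: "x \<in> B \<Longrightarrow> y \<in> B \<Longrightarrow> p (\<lambda>\<omega>. x \<omega> + y \<omega>) \<le> p x + p y"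
  using p unfolding sublinear_on_def by blast

lemma sublinear_scale:
  assumes "x \<in> B" "0 < c"
  shows "p (\<lambda>\<omega>. c * x \<omega>) = c * p x"
proof (rule antisym)
  show "p (\<lambda>\<omega>. c * x \<omega>) \<le> c * p x"
    using p assms unfolding sublinear_on_def by blast
  have "p (\<lambda>\<omega>. (1 / c) * (c * x \<omega>)) \<le> (1 / c) * p (\<lambda>\<omega>. c * x \<omega>)"
    using p function_space_scale[OF assms(1), of c] assms(2) unfolding sublinear_on_def
    by (metis zero_less_divide_1_iff)
  then show "c * p x \<le> p (\<lambda>\<omega>. c * x \<omega>)"
    using assms by (simp add: field_simps)
qed

lemma sublinear_zero: "p (\<lambda>\<omega>. 0) = 0"
  using sublinear_scale[OF function_space_zero, of 2] by simp

lemma sublinear_neg: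
  assumes "x \<in> B"
  shows "0 \<le> p x + p (\<lambda>\<omega>. - x \<omega>)"
  using sublinear_add[OF assms function_space_neg[OF assms]] sublinear_zero by simp

lemma sublinear_diff:
  assumes "x \<in> B" "y \<in> B"
  shows "p y - p (\<lambda>\<omega>. - x \<omega>) \<le> p (\<lambda>\<omega>. x \<omega> + y \<omega>)"
  using sublinear_add[OF function_space_add[OF assms] function_space_neg[OF assms(1)]] by simp

text \<open>Lowering \<open>p\<close> along a ray: the infimum of p (x + t * y) - t * p y over t
  \<ge> 0 is again sublinear, and finite because - p (- x) bounds it below. The parameters 0 and 1
  give the two upper bounds. For minimal \<open>p\<close> the infimum is \<open>p\<close> itself,
  and the second bound becomes superadditivity.\<close>

lemma sublinear_directional:
  assumes y: "y \<in> B"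
  obtains q where "sublinear_on B q" "\<And>x. x \<in> B \<Longrightarrow> q x \<le> p x"
    "\<And>x. x \<in> B \<Longrightarrow> q x \<le> p (\<lambda>\<omega>. x \<omega> + y \<omega>) - p y"
    "\<And>x. x \<notin> B \<Longrightarrow> q x = 0"
proof -
  define S where "S x = (\<lambda>t. p (\<lambda>\<omega>. x \<omega> + t * y \<omega>) - t * p y) ` {0..}" for x
  define q where "q x = (if x \<in> B then Inf (S x) else 0)" for x
  have lower: "- p (\<lambda>\<omega>. - x \<omega>) \<le> s" if x: "x \<in> B" and s: "s \<in> S x" for x s
  proof -
    obtain t where t: "0 \<le> t" "s = p (\<lambda>\<omega>. x \<omega> + t * y \<omega>) - t * p y"
      using s unfolding S_def by auto
    have "p (\<lambda>\<omega>. t * y \<omega>) = t * p y"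
      using t sublinear_scale[OF y, of t] sublinear_zero by (cases "t = 0") auto
    then show ?thesis
      using sublinear_diff[OF x function_space_scale[OF y, of t]] t by simp
  qed
  have bdd: "bdd_below (S x)" if "x \<in> B" for x
    using lower[OF that] by (rule bdd_belowI)
  have le: "q x \<le> p (\<lambda>\<omega>. x \<omega> + t * y \<omega>) - t * p y" if "x \<in> B" "0 \<le> t" for x t
    using that bdd[of x] unfolding q_def by (auto intro!: cInf_lower simp: S_def)
  have ge: "z \<le> q x"
    if "x \<in> B" "\<And>t. 0 \<le> t \<Longrightarrow> z \<le> p (\<lambda>\<omega>. x \<omega> + t * y \<omega>) - t * p y" for x z
    using that unfolding q_def by (auto intro!: cInf_greatest simp: S_def)
  have "sublinear_on B q"
    unfolding sublinear_on_def
  proof (intro conjI ballI allI impI)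
    fix x x' assume x: "x \<in> B" "x' \<in> B"
    let ?z = "\<lambda>\<omega>. x \<omega> + x' \<omega>"
    \<comment> \<open>The other summand is moved to the left so that \<open>ge\<close> handles one
      infimum at a time; the ray parameters t and t' combine to t + t'.\<close>
    have "q ?z - q x' \<le> q x"
    proof (rule ge[OF x(1)])
      fix t :: real assume t: "0 \<le> t"
      have "q ?z - (p (\<lambda>\<omega>. x \<omega> + t * y \<omega>) - t * p y) \<le> q x'"
      proof (rule ge[OF x(2)])
        fix t' :: real assume t': "0 \<le> t'"
        have "q ?z \<le> p (\<lambda>\<omega>. (x \<omega> + x' \<omega>) + (t + t') * y \<omega>) - (t + t') * p y"
          using x t t' by (intro le function_space_add) auto
        also have "(\<lambda>\<omega>. (x \<omega> + x' \<omega>) + (t + t') * y \<omega>) =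
            (\<lambda>\<omega>. (x \<omega> + t * y \<omega>) + (x' \<omega> + t' * y \<omega>))"
          by (auto simp: algebra_simps)
        also have "p \<dots> \<le> p (\<lambda>\<omega>. x \<omega> + t * y \<omega>) + p (\<lambda>\<omega>. x' \<omega> + t' * y \<omega>)"
          using x y by (intro sublinear_add function_space_add function_space_scale)
        finally show "q ?z - (p (\<lambda>\<omega>. x \<omega> + t * y \<omega>) - t * p y)
            \<le> p (\<lambda>\<omega>. x' \<omega> + t' * y \<omega>) - t' * p y"
          by (simp add: algebra_simps)
      qed
      then show "q ?z - q x' \<le> p (\<lambda>\<omega>. x \<omega> + t * y \<omega>) - t * p y" by simp
    qed
    then show "q ?z \<le> q x + q x'" by simp
  next
    fix x and c :: real assume x: "x \<in> B" and c: "0 < c"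
    have "q (\<lambda>\<omega>. c * x \<omega>) / c \<le> q x"
    proof (rule ge[OF x])
      fix t :: real assume t: "0 \<le> t"
      \<comment> \<open>The parameter t at \<open>x\<close> corresponds to c * t at the scaled
        function.\<close>
      have "q (\<lambda>\<omega>. c * x \<omega>) \<le> p (\<lambda>\<omega>. c * x \<omega> + (c * t) * y \<omega>) - (c * t) * p y"
        using x c t by (intro le function_space_scale) auto
      also have "(\<lambda>\<omega>. c * x \<omega> + (c * t) * y \<omega>) = (\<lambda>\<omega>. c * (x \<omega> + t * y \<omega>))"
        by (auto simp: algebra_simps)
      also have "p \<dots> = c * p (\<lambda>\<omega>. x \<omega> + t * y \<omega>)"
        using x y c by (intro sublinear_scale function_space_add function_space_scale)
      finally show "q (\<lambda>\<omega>. c * x \<omega>) / c \<le> p (\<lambda>\<omega>. x \<omega> + t * y \<omega>) - t * p y"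
        using c by (simp add: field_simps)
    qed
    then show "q (\<lambda>\<omega>. c * x \<omega>) \<le> c * q x"
      using c by (simp add: field_simps)
  qed
  moreover have "q x \<le> p x" if "x \<in> B" for x
    using le[OF that, of 0] by simp
  moreover have "q x \<le> p (\<lambda>\<omega>. x \<omega> + y \<omega>) - p y" if "x \<in> B" for x
    using le[OF that, of 1] by simp
  ultimately show thesis
    using that by (simp add: q_def)
qed

end

text \<open>Zorn's lemma is applied to the sublinear functionals below \<open>p\<close>, rather than to partial
  linear extensions: a minimal one is linear by the preceding lemma.\<close>

lemma hahn_banach_additive:
  assumes p: "sublinear_on B p"
  obtains L where "\<And>x. x \<in> B \<Longrightarrow> L x \<le> p x"
    "\<And>x y. x \<in> B \<Longrightarrow> y \<in> B \<Longrightarrow> L (\<lambda>\<omega>. x \<omega> + y \<omega>) = L x + L y"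
proof -
  \<comment> \<open>The value 0 outside \<open>B\<close> makes comparison there trivial and keeps
    infima of chains finite; minimality then gives an equation of total functions.\<close>
  define \<Q> where "\<Q> = {q. sublinear_on B q \<and> (\<forall>x \<in> B. q x \<le> p x) \<and> (\<forall>x. x \<notin> B \<longrightarrow> q x = 0)}"
  \<comment> \<open>The order is reversed: \<open>?P q r\<close> puts \<open>r\<close> below
    \<open>q\<close>. The maximal element from Zorn's lemma is therefore a minimal functional, and
    chains are bounded by pointwise infima.\<close>
  let ?P = "\<lambda>q r. \<forall>x. r x \<le> (q x :: real)"
  have "\<exists>m \<in> \<Q>. \<forall>q \<in> \<Q>. ?P m q \<longrightarrow> q = m"
  proof (rule predicate_Zorn)
    show "partial_order_on \<Q> (relation_of ?P \<Q>)"
      by (rule partial_order_on_relation_ofI) (auto intro: order_trans intro!: ext antisym)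
  next
    fix C assume C: "C \<in> Chains (relation_of ?P \<Q>)"
    show "\<exists>u \<in> \<Q>. \<forall>q \<in> C. ?P q u"
    proof (cases "C = {}")
      case True
      have "(\<lambda>x. if x \<in> B then p x else 0) \<in> \<Q>"
        using p unfolding \<Q>_def sublinear_on_def by (auto simp: function_space_add function_space_scale)
      then show ?thesis using True by blast
    next
      case False
      have sub: "C \<subseteq> \<Q>" using C by (rule Chains_relation_of)
      have total: "?P q r \<or> ?P r q" if "q \<in> C" "r \<in> C" for q r
        using C that unfolding Chains_def relation_of_def by auto
      define u where "u x = (INF q\<in>C. q x)" for x
      have bdd: "bdd_below ((\<lambda>q. q x) ` C)" for x
      proof (cases "x \<in> B")
        case x: True
        \<comment> \<open>This follows from 0 \<le> q x + q (- x) and q \<le> p, and the bound is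
          the same for all members of the chain.\<close>
        have "- p (\<lambda>\<omega>. - x \<omega>) \<le> q x" if "q \<in> C" for q
        proof -
          have "sublinear_on B q" "q (\<lambda>\<omega>. - x \<omega>) \<le> p (\<lambda>\<omega>. - x \<omega>)"
            using sub that function_space_neg[OF x] unfolding \<Q>_def by auto
          then show ?thesis using sublinear_neg[of q x] x by simp
        qed
        then show ?thesis by (rule bdd_belowI2)
      next
        case x: False
        then have "0 \<le> q x" if "q \<in> C" for q using sub that unfolding \<Q>_def by auto
        then show ?thesis by (rule bdd_belowI2)
      qed
      have le: "u x \<le> q x" if "q \<in> C" for q x
        unfolding u_def using that bdd by (intro cINF_lower)
      have ge: "z \<le> u x" if "\<And>q. q \<in> C \<Longrightarrow> z \<le> q x" for z x
        unfolding u_def using that False by (intro cINF_greatest)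
      have "u \<in> \<Q>"
        unfolding \<Q>_def sublinear_on_def
      proof (intro CollectI conjI ballI allI impI)
        fix x y assume xy: "x \<in> B" "y \<in> B"
        have "u (\<lambda>\<omega>. x \<omega> + y \<omega>) - u y \<le> u x"
        proof (rule ge)
          fix q assume q: "q \<in> C"
          have "u (\<lambda>\<omega>. x \<omega> + y \<omega>) - q x \<le> u y"
          proof (rule ge)
            fix r assume r: "r \<in> C"
            \<comment> \<open>In a chain the smaller of \<open>q\<close> and \<open>r\<close> lies
              below both, so the subadditivity of a single functional can be used.\<close>
            obtain s where s: "s \<in> C" "s x \<le> q x" "s y \<le> r y"
              using total[OF q r] q r by blast
            then have "s (\<lambda>\<omega>. x \<omega> + y \<omega>) \<le> s x + s y"
              using sub xy unfolding \<Q>_def sublinear_on_def by blast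
            then show "u (\<lambda>\<omega>. x \<omega> + y \<omega>) - q x \<le> r y"
              using s le[OF s(1), of "\<lambda>\<omega>. x \<omega> + y \<omega>"] by linarith
          qed
          then show "u (\<lambda>\<omega>. x \<omega> + y \<omega>) - u y \<le> q x" by linarith
        qed
        then show "u (\<lambda>\<omega>. x \<omega> + y \<omega>) \<le> u x + u y" by linarith
      next
        fix x and c :: real assume x: "x \<in> B" and c: "0 < c"
        have "u (\<lambda>\<omega>. c * x \<omega>) / c \<le> u x"
        proof (rule ge)
          fix q assume q: "q \<in> C"
          then have "q (\<lambda>\<omega>. c * x \<omega>) \<le> c * q x"
            using sub x c unfolding \<Q>_def sublinear_on_def by blast
          then show "u (\<lambda>\<omega>. c * x \<omega>) / c \<le> q x"
            using c le[OF q, of "\<lambda>\<omega>. c * x \<omega>"] by (simp add: field_simps)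
        qed
        then show "u (\<lambda>\<omega>. c * x \<omega>) \<le> c * u x"
          using c by (simp add: field_simps)
      next
        fix x assume "x \<in> B"
        moreover obtain q where "q \<in> C" using False by blast
        ultimately show "u x \<le> p x"
          using sub le[of q x] unfolding \<Q>_def by force
      next
        fix x assume x: "x \<notin> B"
        have zero: "q x = 0" if "q \<in> C" for q
          using sub x that unfolding \<Q>_def by blast
        obtain q where "q \<in> C" using False by blast
        then have "u x \<le> 0" using le[of q x] zero[of q] by simp
        moreover have "0 \<le> u x" by (rule ge) (simp add: zero[THEN eq_refl[OF sym]])
        ultimately show "u x = 0" by simp
      qed
      then show ?thesis using le by blast
    qed
  qed
  then obtain m where m: "m \<in> \<Q>" and minimal: "\<And>q. q \<in> \<Q> \<Longrightarrow> ?P m q \<Longrightarrow> q = m"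
    by blast
  have sm: "sublinear_on B m" using m unfolding \<Q>_def by blast
  have "m (\<lambda>\<omega>. x \<omega> + y \<omega>) = m x + m y" if x: "x \<in> B" and y: "y \<in> B" for x y
  proof (rule antisym)
    show "m (\<lambda>\<omega>. x \<omega> + y \<omega>) \<le> m x + m y"
      using sublinear_add[OF sm x y] .
    \<comment> \<open>Lowering \<open>m\<close> in the direction \<open>y\<close> yields a member of
      \<Q> below \<open>m\<close>, hence \<open>m\<close> itself; the bound for the ray parameter 1
      is then superadditivity of \<open>m\<close>.\<close>
    obtain q where q: "sublinear_on B q" "\<And>x. x \<in> B \<Longrightarrow> q x \<le> m x"
      "\<And>x. x \<in> B \<Longrightarrow> q x \<le> m (\<lambda>\<omega>. x \<omega> + y \<omega>) - m y" "\<And>x. x \<notin> B \<Longrightarrow> q x = 0"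
      using sublinear_directional[OF sm y] by blast
    have "q z \<le> m z" for z
      using q(2,4)[of z] m unfolding \<Q>_def by (cases "z \<in> B") auto
    moreover have "q x \<le> p x" if "x \<in> B" for x
      using q(2)[OF that] m that unfolding \<Q>_def by force
    then have "q \<in> \<Q>"
      using q(1,4) unfolding \<Q>_def by blast
    ultimately have "q = m" using minimal by blast
    then show "m x + m y \<le> m (\<lambda>\<omega>. x \<omega> + y \<omega>)" using q(3)[OF x] by simp
  qed
  moreover have "m x \<le> p x" if "x \<in> B" for x
    using m that unfolding \<Q>_def by blast
  ultimately show thesis using that by blast
qed

end

section \<open>Bounded measurable functions\<close>

lemma bounded_measurable_level_set:
  assumes "sigma_algebra \<Omega> \<A>" "x \<in> bounded_measurable \<Omega> \<A>"
  shows "{\<omega> \<in> \<Omega>. t \<le> x \<omega>} \<in> \<A>"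
proof -
  interpret sigma_algebra \<Omega> \<A> by fact
  have [measurable]: "x \<in> borel_measurable (sigma \<Omega> \<A>)"
    using assms unfolding bounded_measurable_def by blast
  have "{\<omega> \<in> space (sigma \<Omega> \<A>). t \<le> x \<omega>} \<in> sets (sigma \<Omega> \<A>)"
    by measurable
  then show ?thesis
    by (simp add: space_measure_of_conv)
qed

lemma bounded_measurable_bound:
  assumes "x \<in> bounded_measurable \<Omega> \<A>"
  shows "\<exists>M. \<forall>\<omega> \<in> \<Omega>. \<bar>x \<omega>\<bar> \<le> M"
  using assms unfolding bounded_measurable_def bounded_iff by auto

lemma bounded_measurable_linear_function_space:
  "linear_function_space (bounded_measurable \<Omega> \<A>)"
  unfolding linear_function_space_def
proof (intro conjI ballI allI)
  have "(\<lambda>\<omega>. 0) \<in> bounded_measurable \<Omega> \<A>"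
    unfolding bounded_measurable_def by (auto simp: bounded_iff)
  then show "bounded_measurable \<Omega> \<A> \<noteq> {}" by blast
next
  fix x y a b assume x: "x \<in> bounded_measurable \<Omega> \<A>" and y: "y \<in> bounded_measurable \<Omega> \<A>"
  obtain M where M: "\<forall>\<omega> \<in> \<Omega>. \<bar>x \<omega>\<bar> \<le> M"
    using bounded_measurable_bound[OF x] ..
  obtain N where N: "\<forall>\<omega> \<in> \<Omega>. \<bar>y \<omega>\<bar> \<le> N"
    using bounded_measurable_bound[OF y] ..
  have "\<bar>a * x \<omega> + b * y \<omega>\<bar> \<le> \<bar>a\<bar> * M + \<bar>b\<bar> * N" if "\<omega> \<in> \<Omega>" for \<omega>
  proof -
    have "\<bar>a * x \<omega> + b * y \<omega>\<bar> \<le> \<bar>a\<bar> * \<bar>x \<omega>\<bar> + \<bar>b\<bar> * \<bar>y \<omega>\<bar>"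
      by (metis abs_mult abs_triangle_ineq)
    also have "\<dots> \<le> \<bar>a\<bar> * M + \<bar>b\<bar> * N"
      using M N that by (intro add_mono mult_left_mono) auto
    finally show ?thesis .
  qed
  then have "bounded ((\<lambda>\<omega>. a * x \<omega> + b * y \<omega>) ` \<Omega>)"
    unfolding bounded_iff by auto
  then show "(\<lambda>\<omega>. a * x \<omega> + b * y \<omega>) \<in> bounded_measurable \<Omega> \<A>"
    using x y unfolding bounded_measurable_def by auto
qed

lemmas bounded_measurable_add = function_space_add[OF bounded_measurable_linear_function_space]
  and bounded_measurable_scale = function_space_scale[OF bounded_measurable_linear_function_space]
  and bounded_measurable_neg = function_space_neg[OF bounded_measurable_linear_function_space]
  and bounded_measurable_zero = function_space_zero[OF bounded_measurable_linear_function_space]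

lemma bounded_measurable_indicator:
  assumes "sigma_algebra \<Omega> \<A>" "A \<in> \<A>"
  shows "indicator A \<in> bounded_measurable \<Omega> \<A>"
proof -
  interpret sigma_algebra \<Omega> \<A> by fact
  have "indicator A \<in> borel_measurable (sigma \<Omega> \<A>)"
    using assms(2) by (intro borel_measurable_indicator) simp
  moreover have "bounded ((indicator A :: 'a \<Rightarrow> real) ` \<Omega>)"
    by (rule boundedI[of _ 1]) (auto simp: indicator_def)
  moreover have "\<forall>\<omega>. \<omega> \<notin> \<Omega> \<longrightarrow> indicator A \<omega> = (0 :: real)"
    using sets_into_space[OF assms(2)] by (auto simp: indicator_def)
  ultimately show ?thesis unfolding bounded_measurable_def by simp
qed

section \<open>Arbitrage freeness and the anticore\<close>

lemma sum_nth_eq_sum_list: "(\<Sum>i = 1..length ys. g (ys ! (i - 1))) = (\<Sum>y\<leftarrow>ys. g y)"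
  for g :: "'b \<Rightarrow> real"
  unfolding One_nat_def sum.atLeast1_atMost_eq sum_list_sum_nth
  by (simp add: atLeast0LessThan)

text \<open>With lists, joining portfolios is concatenation; the shift \<open>i - 1\<close>
  reconciles indices starting at 1 with \<open>nth\<close>.\<close>

lemma arbitrage_free_list:
  assumes "arbitrage_free \<Omega> \<A> f" "set ys \<subseteq> bounded_measurable \<Omega> \<A>"
    and "\<And>\<omega>. \<omega> \<in> \<Omega> \<Longrightarrow> 0 \<le> (\<Sum>y\<leftarrow>ys. y \<omega>)"
  shows "0 \<le> (\<Sum>y\<leftarrow>ys. f y)"
proof -
  have "ys ! (i - 1) \<in> bounded_measurable \<Omega> \<A>" if "i \<in> {1..length ys}" for i
    using assms(2) that by (auto intro!: subsetD[OF assms(2)] nth_mem)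
  moreover have "\<forall>\<omega> \<in> \<Omega>. 0 \<le> (\<Sum>i = 1..length ys. (ys ! (i - 1)) \<omega>)"
    using assms(3) sum_nth_eq_sum_list[of "\<lambda>y. y \<omega>" ys for \<omega>] by simp
  ultimately have "0 \<le> (\<Sum>i = 1..length ys. f (ys ! (i - 1)))"
    using assms(1)[unfolded arbitrage_free_def, rule_format, of "length ys" "\<lambda>i. ys ! (i - 1)"]
    by blast
  then show ?thesis using sum_nth_eq_sum_list[of f ys] by simp
qed

text \<open>Two particular portfolios give the bounds on \<open>L\<close>: a claim hedges itself,
  whence L \<le> f, and the empty portfolio hedges every non-positive claim at no cost, whence the
  sign condition. For additive \<open>L\<close> the latter is monotonicity.\<close>

lemma arbitrage_free_dominates_additive:
  assumes af: "arbitrage_free \<Omega> \<A> f"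
    and hom: "\<And>x c. x \<in> bounded_measurable \<Omega> \<A> \<Longrightarrow> 0 < c \<Longrightarrow> f (\<lambda>\<omega>. c * x \<omega>) = c * f x"
  obtains L where "\<And>x. x \<in> bounded_measurable \<Omega> \<A> \<Longrightarrow> L x \<le> f x"
    "\<And>x y. x \<in> bounded_measurable \<Omega> \<A> \<Longrightarrow> y \<in> bounded_measurable \<Omega> \<A> \<Longrightarrow>
      L (\<lambda>\<omega>. x \<omega> + y \<omega>) = L x + L y"
    "\<And>x. x \<in> bounded_measurable \<Omega> \<A> \<Longrightarrow> (\<And>\<omega>. \<omega> \<in> \<Omega> \<Longrightarrow> x \<omega> \<le> 0) \<Longrightarrow> L x \<le> 0"
proof -
  let ?B = "bounded_measurable \<Omega> \<A>"
  define H where "H x = {ys. set ys \<subseteq> ?B \<and> (\<forall>\<omega> \<in> \<Omega>. x \<omega> \<le> (\<Sum>y\<leftarrow>ys. y \<omega>))}" for x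
  define p where "p x = (INF ys\<in>H x. \<Sum>y\<leftarrow>ys. f y)" for x
  have self: "[x] \<in> H x" if "x \<in> ?B" for x
    using that unfolding H_def by simp
  \<comment> \<open>A portfolio hedging \<open>x\<close>, joined with the claim - x, has a
    non-negative sum; arbitrage freeness thus bounds its cost below, and the infimum is
    finite.\<close>
  have lower: "- f (\<lambda>\<omega>. - x \<omega>) \<le> (\<Sum>y\<leftarrow>ys. f y)" if "x \<in> ?B" "ys \<in> H x" for x ys
  proof -
    have "0 \<le> (\<Sum>y\<leftarrow>(\<lambda>\<omega>. - x \<omega>) # ys. f y)"
      using that unfolding H_def
      by (intro arbitrage_free_list[OF af]) (auto intro: bounded_measurable_neg)
    then show ?thesis by simp
  qed
  have le: "p x \<le> (\<Sum>y\<leftarrow>ys. f y)" if "x \<in> ?B" "ys \<in> H x" for x ys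
    unfolding p_def using lower[OF that(1)] that(2) by (intro cINF_lower bdd_belowI2)
  have ge: "z \<le> p x" if "x \<in> ?B" "\<And>ys. ys \<in> H x \<Longrightarrow> z \<le> (\<Sum>y\<leftarrow>ys. f y)" for x z
    unfolding p_def using that self by (intro cINF_greatest) auto
  have sublinear: "sublinear_on ?B p"
    unfolding sublinear_on_def
  proof (intro conjI ballI allI impI)
    fix x x' assume x: "x \<in> ?B" "x' \<in> ?B"
    let ?z = "\<lambda>\<omega>. x \<omega> + x' \<omega>"
    have z: "?z \<in> ?B" using x by (rule bounded_measurable_add)
    have "p ?z - p x' \<le> p x"
    proof (rule ge[OF x(1)])
      fix ys assume ys: "ys \<in> H x"
      have "p ?z - (\<Sum>y\<leftarrow>ys. f y) \<le> p x'"
      proof (rule ge[OF x(2)])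
        fix ys' assume ys': "ys' \<in> H x'"
        \<comment> \<open>Hedges of two claims, taken together, hedge their sum: this is
          subadditivity of \<open>p\<close>.\<close>
        have "ys @ ys' \<in> H ?z"
          using ys ys' unfolding H_def by (auto intro: add_mono)
        then show "p ?z - (\<Sum>y\<leftarrow>ys. f y) \<le> (\<Sum>y\<leftarrow>ys'. f y)"
          using le[OF z, of "ys @ ys'"] by simp
      qed
      then show "p ?z - p x' \<le> (\<Sum>y\<leftarrow>ys. f y)" by linarith
    qed
    then show "p ?z \<le> p x + p x'" by linarith
  next
    fix x and c :: real assume x: "x \<in> ?B" and c: "0 < c"
    have "p (\<lambda>\<omega>. c * x \<omega>) / c \<le> p x"
    proof (rule ge[OF x])
      fix ys assume ys: "ys \<in> H x"
      let ?ys = "map (\<lambda>y \<omega>. c * y \<omega>) ys"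
      have "?ys \<in> H (\<lambda>\<omega>. c * x \<omega>)"
        using ys c unfolding H_def
        by (auto simp: o_def sum_list_const_mult intro: bounded_measurable_scale)
      then have "p (\<lambda>\<omega>. c * x \<omega>) \<le> (\<Sum>y\<leftarrow>?ys. f y)"
        by (rule le[OF bounded_measurable_scale[OF x]])
      also have "\<dots> = (\<Sum>y\<leftarrow>ys. c * f y)"
        using ys c hom unfolding H_def map_map o_def
        by (intro arg_cong[where f = sum_list] map_cong) auto
      also have "\<dots> = c * (\<Sum>y\<leftarrow>ys. f y)"
        by (rule sum_list_const_mult)
      finally show "p (\<lambda>\<omega>. c * x \<omega>) / c \<le> (\<Sum>y\<leftarrow>ys. f y)"
        using c by (simp add: field_simps)
    qed
    then show "p (\<lambda>\<omega>. c * x \<omega>) \<le> c * p x"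
      using c by (simp add: field_simps)
  qed
  obtain L where L: "\<And>x. x \<in> ?B \<Longrightarrow> L x \<le> p x"
    "\<And>x y. x \<in> ?B \<Longrightarrow> y \<in> ?B \<Longrightarrow> L (\<lambda>\<omega>. x \<omega> + y \<omega>) = L x + L y"
  proof (rule hahn_banach_additive[OF bounded_measurable_linear_function_space sublinear])
    fix L assume "\<And>x. x \<in> ?B \<Longrightarrow> L x \<le> p x"
      "\<And>x y. x \<in> ?B \<Longrightarrow> y \<in> ?B \<Longrightarrow> L (\<lambda>\<omega>. x \<omega> + y \<omega>) = L x + L y"
    then show thesis by (rule that)
  qed
  show thesis
  proof (rule that[of L])
    fix x assume x: "x \<in> ?B"
    show "L x \<le> f x"
      using L(1)[OF x] le[OF x self[OF x]] by simp
  next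
    fix x assume x: "x \<in> ?B" "\<And>\<omega>. \<omega> \<in> \<Omega> \<Longrightarrow> x \<omega> \<le> 0"
    then have "[] \<in> H x" unfolding H_def by simp
    then show "L x \<le> 0" using L(1)[OF x(1)] le[OF x(1), of "[]"] by simp
  next
    fix x y assume "x \<in> ?B" "y \<in> ?B"
    then show "L (\<lambda>\<omega>. x \<omega> + y \<omega>) = L x + L y" by (rule L(2))
  qed
qed

lemma anticore_nonempty_if_arbitrage_free:
  assumes sa: "sigma_algebra \<Omega> \<A>" and v: "capacity \<A> v"
    and f: "choquet_pricing_rule \<Omega> \<A> v f" and af: "arbitrage_free \<Omega> \<A> f"
  shows "anticore \<Omega> \<A> v \<noteq> {}"
proof -
  interpret sigma_algebra \<Omega> \<A> by fact
  let ?B = "bounded_measurable \<Omega> \<A>"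
  have f_eq: "f x = choquet_integral \<Omega> v x" if "x \<in> ?B" for x
    using f that unfolding choquet_pricing_rule_def by blast
  have v0: "v {} = 0" using v unfolding capacity_def by blast
  obtain L where L: "\<And>x. x \<in> ?B \<Longrightarrow> L x \<le> f x"
    "\<And>x y. x \<in> ?B \<Longrightarrow> y \<in> ?B \<Longrightarrow> L (\<lambda>\<omega>. x \<omega> + y \<omega>) = L x + L y"
    "\<And>x. x \<in> ?B \<Longrightarrow> (\<And>\<omega>. \<omega> \<in> \<Omega> \<Longrightarrow> x \<omega> \<le> 0) \<Longrightarrow> L x \<le> 0"
  proof (rule arbitrage_free_dominates_additive[OF af])
    fix x and c :: real assume "x \<in> ?B" "0 < c"
    then show "f (\<lambda>\<omega>. c * x \<omega>) = c * f x"
      by (simp add: f_eq bounded_measurable_scale choquet_integral_pos_homogeneous)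
  next
    fix L assume "\<And>x. x \<in> ?B \<Longrightarrow> L x \<le> f x"
      "\<And>x y. x \<in> ?B \<Longrightarrow> y \<in> ?B \<Longrightarrow> L (\<lambda>\<omega>. x \<omega> + y \<omega>) = L x + L y"
      "\<And>x. x \<in> ?B \<Longrightarrow> (\<And>\<omega>. \<omega> \<in> \<Omega> \<Longrightarrow> x \<omega> \<le> 0) \<Longrightarrow> L x \<le> 0"
    then show thesis by (rule that)
  qed
  have L0: "L (\<lambda>\<omega>. 0) = 0"
    using L(2)[OF bounded_measurable_zero bounded_measurable_zero] by simp
  have Lneg: "L (\<lambda>\<omega>. - x \<omega>) = - L x" if "x \<in> ?B" for x
    using L(2)[OF that bounded_measurable_neg[OF that]] L0 by simp
  note ind = bounded_measurable_indicator[OF sa]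
  define \<mu> where "\<mu> A = L (indicator A)" for A
  have le: "\<mu> A \<le> v A" if "A \<in> \<A>" for A
    using L(1)[OF ind[OF that]] f_eq[OF ind[OF that]]
      choquet_integral_indicator[of v A \<Omega>] v0 sets_into_space[OF that]
    unfolding \<mu>_def by simp
  have "0 \<le> \<mu> A" if "A \<in> \<A>" for A
    using L(3)[OF bounded_measurable_neg[OF ind[OF that]]] Lneg[OF ind[OF that]]
    unfolding \<mu>_def by simp
  moreover have "additive \<A> \<mu>"
    unfolding additive_def
  proof (intro ballI impI)
    fix A B assume "A \<in> \<A>" "B \<in> \<A>" "A \<inter> B = {}"
    moreover from this have "indicator (A \<union> B) = (\<lambda>\<omega>. indicator A \<omega> + indicator B \<omega> :: real)"
      by (intro ext) (auto simp: indicator_def)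
    ultimately show "\<mu> (A \<union> B) = \<mu> A + \<mu> B"
      unfolding \<mu>_def using L(2) ind by simp
  qed
  \<comment> \<open>The claim -1 gives the reverse inequality: - \<mu> \<Omega> is \<open>L\<close>
    at -1, which is at most \<open>f\<close> at -1, that is - v \<Omega>.\<close>
  moreover have "v \<Omega> \<le> \<mu> \<Omega>"
    using L(1)[OF bounded_measurable_neg[OF ind[OF top]]] Lneg[OF ind[OF top]]
      f_eq[OF bounded_measurable_neg[OF ind[OF top]]] choquet_integral_neg_one[of v \<Omega>] v0
    unfolding \<mu>_def by simp
  then have "\<mu> \<Omega> = v \<Omega>" using le[OF top] by simp
  ultimately have "\<mu> \<in> anticore \<Omega> \<A> v"
    unfolding anticore_def using le by blast
  then show ?thesis by blast
qed

section \<open>Charges and integer-valued simple functions\<close>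

lemma sum_of_bool_threshold:
  assumes "\<bar>c\<bar> \<le> int K"
  shows "(\<Sum>k = 1..2 * K. of_bool (int k - int K \<le> c) :: real) = real_of_int c + real K"
proof -
  \<comment> \<open>Exactly c + K of the levels 1 - K, ..., K lie at or below c, so counting levels
    recovers an integer in [-K, K] up to the shift K.\<close>
  have "{1..2 * K} \<inter> {k. int k - int K \<le> c} = {1..nat (c + int K)}"
    using assms by auto
  then show ?thesis using assms by (simp add: sum_of_bool_eq del: One_nat_def)
qed

lemma additive_finite_UN:
  fixes \<mu> :: "'a set \<Rightarrow> real"
  assumes ring: "ring_of_sets \<Omega> \<A>" and \<mu>: "additive \<A> \<mu>"
    and S: "finite S" "\<forall>s \<in> S. A s \<in> \<A>" "disjoint_family_on A S"
  shows "(\<Sum>s\<in>S. \<mu> (A s)) = \<mu> (\<Union>s\<in>S. A s)"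
proof -
  interpret ring_of_sets \<Omega> \<A> by fact
  have add: "\<mu> (U \<union> V) = \<mu> U + \<mu> V" if "U \<in> \<A>" "V \<in> \<A>" "U \<inter> V = {}" for U V
    using \<mu> that unfolding additive_def by blast
  show ?thesis
    using S
  proof (induction S rule: finite_induct)
    case empty
    \<comment> \<open>Additivity for two empty sets forces the value 0.\<close>
    show ?case using add[of "{}" "{}"] by simp
  next
    case (insert s S)
    let ?U = "\<Union>s\<in>S. A s"
    have "(\<Sum>s\<in>insert s S. \<mu> (A s)) = \<mu> (A s) + (\<Sum>s\<in>S. \<mu> (A s))"
      using insert.hyps by simp
    also have "(\<Sum>s\<in>S. \<mu> (A s)) = \<mu> ?U"
      using insert.prems(1)
      by (intro insert.IH disjoint_family_on_mono[OF _ insert.prems(2)]) auto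
    also have "\<mu> (A s) + \<mu> ?U = \<mu> (A s \<union> ?U)"
    proof (rule add[symmetric])
      show "A s \<in> \<A>" using insert.prems(1) by blast
      show "?U \<in> \<A>" using insert.prems(1) insert.hyps(1) by (intro finite_UN) auto
      have "A s \<inter> A t = {}" if "t \<in> S" for t
        using disjoint_family_onD[OF insert.prems(2), of s t] insert.hyps(2) that by auto
      then show "A s \<inter> ?U = {}" by (simp add: Int_UN_distrib)
    qed
    also have "A s \<union> ?U = (\<Union>s\<in>insert s S. A s)" by blast
    finally show ?case .
  qed
qed

text \<open>Both sides of the inequality are integrals of simple functions, computed on the finite
  partition of \<open>\<Omega>\<close> into the sets where all \<open>y i\<close> are constant.\<close>

lemma additive_lower_sums_ge:
  fixes y :: "'i \<Rightarrow> 'a \<Rightarrow> int"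
  assumes sa: "sigma_algebra \<Omega> \<A>" and \<mu>: "additive \<A> \<mu>" "\<And>A. A \<in> \<A> \<Longrightarrow> 0 \<le> \<mu> A"
    and I: "finite I"
    and meas: "\<And>i k. i \<in> I \<Longrightarrow> {\<omega> \<in> \<Omega>. k \<le> y i \<omega>} \<in> \<A>"
    and bound: "\<And>i \<omega>. i \<in> I \<Longrightarrow> \<omega> \<in> \<Omega> \<Longrightarrow> \<bar>y i \<omega>\<bar> \<le> int K"
    and sum: "\<And>\<omega>. \<omega> \<in> \<Omega> \<Longrightarrow> - m \<le> (\<Sum>i\<in>I. y i \<omega>)"
  shows "- real_of_int m * \<mu> \<Omega> \<le>
    (\<Sum>i\<in>I. (\<Sum>k = 1..2 * K. \<mu> {\<omega> \<in> \<Omega>. int k - int K \<le> y i \<omega>}) - real K * \<mu> \<Omega>)"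
proof -
  interpret sigma_algebra \<Omega> \<A> by fact
  \<comment> \<open>Restriction to \<open>I\<close> fixes the values elsewhere, so \<open>Y\<close>
    takes values in a finite product; its fibres \<open>D c\<close> are the atoms of the
    partition.\<close>
  define Y where "Y \<omega> = restrict (\<lambda>i. y i \<omega>) I" for \<omega>
  define D where "D c = {\<omega> \<in> \<Omega>. Y \<omega> = c}" for c
  have F: "finite (Y ` \<Omega>)"
  proof (rule finite_subset)
    show "Y ` \<Omega> \<subseteq> I \<rightarrow>\<^sub>E {- int K..int K}"
      using bound unfolding Y_def by (fastforce simp: abs_le_iff)
    show "finite (I \<rightarrow>\<^sub>E {- int K..int K})"
      using I by (intro finite_PiE) auto
  qed
  have D: "D c \<in> \<A>" if c: "c \<in> Y ` \<Omega>" for c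
  proof -
    have "{\<omega> \<in> \<Omega>. y i \<omega> = c i} \<in> \<A>" if "i \<in> I" for i
    proof -
      \<comment> \<open>Since the values are integers, a fibre is the difference of two consecutive
        upper level sets.\<close>
      have "{\<omega> \<in> \<Omega>. y i \<omega> = c i} = {\<omega> \<in> \<Omega>. c i \<le> y i \<omega>} - {\<omega> \<in> \<Omega>. c i + 1 \<le> y i \<omega>}"
        by auto
      then show ?thesis using Diff[OF meas[OF that] meas[OF that]] by simp
    qed
    then have "{\<omega> \<in> \<Omega>. \<forall>i\<in>I. y i \<omega> = c i} \<in> \<A>"
      using I by (intro sets_Collect_finite_All)
    \<comment> \<open>As a value of \<open>Y\<close>, the function \<open>c\<close> is extensional,
      so agreement on \<open>I\<close> is equality of functions.\<close>
    moreover have "{\<omega> \<in> \<Omega>. \<forall>i\<in>I. y i \<omega> = c i} = D c"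
      using c unfolding D_def Y_def by (auto simp: fun_eq_iff restrict_def)
    ultimately show ?thesis by simp
  qed
  have partition: "\<mu> {\<omega> \<in> \<Omega>. P (Y \<omega>)} = (\<Sum>c\<in>Y ` \<Omega>. \<mu> (D c) * of_bool (P c))" for P
  proof -
    have "(\<Sum>c\<in>Y ` \<Omega>. \<mu> (D c) * of_bool (P c)) = (\<Sum>c\<in>{c \<in> Y ` \<Omega>. P c}. \<mu> (D c))"
      using F by (intro sum.mono_neutral_cong_right) auto
    also have "\<dots> = \<mu> (\<Union>c\<in>{c \<in> Y ` \<Omega>. P c}. D c)"
      using F D
      by (intro additive_finite_UN[OF ring_of_sets_axioms \<mu>(1)])
        (auto simp: disjoint_family_on_def D_def)
    also have "(\<Union>c\<in>{c \<in> Y ` \<Omega>. P c}. D c) = {\<omega> \<in> \<Omega>. P (Y \<omega>)}"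
      unfolding D_def by auto
    finally show ?thesis by simp
  qed
  have total: "\<mu> \<Omega> = (\<Sum>c\<in>Y ` \<Omega>. \<mu> (D c))"
    using partition[of "\<lambda>_. True"] by simp
  \<comment> \<open>Exchanging the sums over levels and atoms and counting the levels below each
    value gives the integral of \<open>y i\<close>; the surplus K on every atom cancels against
    \<open>real K * \<mu> \<Omega>\<close>.\<close>
  have *: "(\<Sum>k = 1..2 * K. \<mu> {\<omega> \<in> \<Omega>. int k - int K \<le> y i \<omega>}) - real K * \<mu> \<Omega> =
      (\<Sum>c\<in>Y ` \<Omega>. \<mu> (D c) * real_of_int (c i))" if i: "i \<in> I" for i
  proof -
    have "(\<Sum>k = 1..2 * K. \<mu> {\<omega> \<in> \<Omega>. int k - int K \<le> y i \<omega>}) =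
        (\<Sum>k = 1..2 * K. \<Sum>c\<in>Y ` \<Omega>. \<mu> (D c) * of_bool (int k - int K \<le> c i))"
      using i partition[of "\<lambda>c. int k - int K \<le> c i" for k] unfolding Y_def by simp
    also have "\<dots> = (\<Sum>c\<in>Y ` \<Omega>. \<mu> (D c) * (\<Sum>k = 1..2 * K. of_bool (int k - int K \<le> c i)))"
      by (subst sum.swap) (simp only: sum_distrib_left)
    also have "\<dots> = (\<Sum>c\<in>Y ` \<Omega>. \<mu> (D c) * (real_of_int (c i) + real K))"
      using bound i
      by (intro sum.cong refl arg_cong[where f = "(*) _"] sum_of_bool_threshold) (auto simp: Y_def)
    finally show ?thesis
      by (simp add: total algebra_simps sum.distrib sum_distrib_left)
  qed
  have "- real_of_int m * \<mu> \<Omega> = (\<Sum>c\<in>Y ` \<Omega>. \<mu> (D c) * - real_of_int m)"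
    by (simp add: total sum_distrib_left sum_distrib_right mult.commute sum_negf)
  also have "\<dots> \<le> (\<Sum>c\<in>Y ` \<Omega>. \<mu> (D c) * (\<Sum>i\<in>I. real_of_int (c i)))"
  proof (intro sum_mono mult_left_mono)
    fix c assume c: "c \<in> Y ` \<Omega>"
    then show "0 \<le> \<mu> (D c)" using \<mu>(2) D by blast
    \<comment> \<open>Atoms are non-empty, so the pointwise hypothesis can be read off at one of
      their points.\<close>
    obtain \<omega> where "\<omega> \<in> \<Omega>" "c = Y \<omega>" using c by blast
    then have "- m \<le> (\<Sum>i\<in>I. c i)" using sum[of \<omega>] by (simp add: Y_def)
    then show "- real_of_int m \<le> (\<Sum>i\<in>I. real_of_int (c i))"
      by (metis of_int_le_iff of_int_minus of_int_sum)
  qed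
  also have "\<dots> = (\<Sum>i\<in>I. \<Sum>c\<in>Y ` \<Omega>. \<mu> (D c) * real_of_int (c i))"
    by (subst sum.swap) (simp add: sum_distrib_left)
  finally show ?thesis using * by simp
qed

text \<open>After scaling by N, rounding down costs at most one unit per claim, hence at most
  \<open>card I\<close> times the total mass, whatever N is. Homogeneity then bounds N times the sum
  of the integrals below by a constant independent of N, which excludes a negative sum.\<close>

lemma sum_choquet_integral_nonneg:
  assumes sa: "sigma_algebra \<Omega> \<A>" and v: "capacity \<A> v" and \<mu>: "\<mu> \<in> anticore \<Omega> \<A> v"
    and I: "finite I" and x: "\<And>i. i \<in> I \<Longrightarrow> x i \<in> bounded_measurable \<Omega> \<A>"
    and pos: "\<And>\<omega>. \<omega> \<in> \<Omega> \<Longrightarrow> 0 \<le> (\<Sum>i\<in>I. x i \<omega>)"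
  shows "0 \<le> (\<Sum>i\<in>I. choquet_integral \<Omega> v (x i))"
proof -
  interpret sigma_algebra \<Omega> \<A> by fact
  let ?B = "bounded_measurable \<Omega> \<A>"
  have \<mu>': "additive \<A> \<mu>" "\<And>A. A \<in> \<A> \<Longrightarrow> 0 \<le> \<mu> A" "\<And>A. A \<in> \<A> \<Longrightarrow> \<mu> A \<le> v A" "\<mu> \<Omega> = v \<Omega>"
    using \<mu> unfolding anticore_def by auto
  have "bounded (\<Union>i\<in>I. x i ` \<Omega>)"
    using I x unfolding bounded_measurable_def by (intro bounded_UN) auto
  then obtain M where M: "\<And>i \<omega>. i \<in> I \<Longrightarrow> \<omega> \<in> \<Omega> \<Longrightarrow> \<bar>x i \<omega>\<bar> \<le> M"
    unfolding bounded_iff by auto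
  let ?S = "\<Sum>i\<in>I. choquet_integral \<Omega> v (x i)"
  have scaled: "- real (card I) * v \<Omega> \<le> real N * ?S" if N: "0 < N" for N :: nat
  proof -
    define z where "z i \<omega> = real N * x i \<omega>" for i \<omega>
    \<comment> \<open>A common bound for all scaled claims; being an integer, it bounds their floors
      as well.\<close>
    define K where "K = nat \<lceil>real N * M\<rceil>"
    have z: "z i \<in> ?B" if "i \<in> I" for i
      unfolding z_def using x[OF that] by (rule bounded_measurable_scale)
    have zK: "\<bar>z i \<omega>\<bar> \<le> real K" if "i \<in> I" "\<omega> \<in> \<Omega>" for i \<omega>
    proof -
      have "\<bar>z i \<omega>\<bar> \<le> real N * M"
        using M[OF that] unfolding z_def by (simp add: abs_mult mult_left_mono)
      then show ?thesis unfolding K_def by linarith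
    qed
    have floor_level: "{\<omega> \<in> \<Omega>. k \<le> \<lfloor>z i \<omega>\<rfloor>} = {\<omega> \<in> \<Omega>. real_of_int k \<le> z i \<omega>}" for i k
      by (simp add: le_floor_iff)
    have level: "{\<omega> \<in> \<Omega>. t \<le> z i \<omega>} \<in> \<A>" if "i \<in> I" for i t
      using bounded_measurable_level_set[OF sa z[OF that]] .
    have "- real_of_int (int (card I)) * \<mu> \<Omega> \<le>
      (\<Sum>i\<in>I. (\<Sum>k = 1..2 * K. \<mu> {\<omega> \<in> \<Omega>. int k - int K \<le> \<lfloor>z i \<omega>\<rfloor>}) - real K * \<mu> \<Omega>)"
    proof (rule additive_lower_sums_ge[OF sa \<mu>'(1,2) I])
      fix i k assume "i \<in> I"
      then show "{\<omega> \<in> \<Omega>. k \<le> \<lfloor>z i \<omega>\<rfloor>} \<in> \<A>"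
        unfolding floor_level by (rule level)
    next
      fix i \<omega> assume "i \<in> I" "\<omega> \<in> \<Omega>"
      then show "\<bar>\<lfloor>z i \<omega>\<rfloor>\<bar> \<le> int K"
        using zK[of i \<omega>] by linarith
    next
      fix \<omega> assume \<omega>: "\<omega> \<in> \<Omega>"
      have "- real (card I) \<le> real N * (\<Sum>i\<in>I. x i \<omega>) - real (card I)"
        using pos[OF \<omega>] by simp
      also have "\<dots> = (\<Sum>i\<in>I. z i \<omega> - 1)"
        by (simp add: z_def sum_subtractf sum_distrib_left)
      also have "\<dots> \<le> (\<Sum>i\<in>I. real_of_int \<lfloor>z i \<omega>\<rfloor>)"
        by (intro sum_mono) linarith
      finally have "real_of_int (- int (card I)) \<le> real_of_int (\<Sum>i\<in>I. \<lfloor>z i \<omega>\<rfloor>)"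
        by simp
      then show "- int (card I) \<le> (\<Sum>i\<in>I. \<lfloor>z i \<omega>\<rfloor>)"
        by (simp only: of_int_le_iff)
    qed
    also have "\<dots> \<le> (\<Sum>i\<in>I. choquet_integral \<Omega> v (z i))"
    proof (rule sum_mono)
      fix i assume i: "i \<in> I"
      \<comment> \<open>The comparison \<mu> \<le> v is applied level by level, while the subtracted
        term is unchanged because the total masses agree.\<close>
      have "(\<Sum>k = 1..2 * K. \<mu> {\<omega> \<in> \<Omega>. int k - int K \<le> \<lfloor>z i \<omega>\<rfloor>})
          \<le> (\<Sum>k = 1..2 * K. v {\<omega> \<in> \<Omega>. real k - real K \<le> z i \<omega>})"
        unfolding floor_level using \<mu>'(3)[OF level[OF i]] by (intro sum_mono) simp
      then show "(\<Sum>k = 1..2 * K. \<mu> {\<omega> \<in> \<Omega>. int k - int K \<le> \<lfloor>z i \<omega>\<rfloor>}) - real K * \<mu> \<Omega>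
          \<le> choquet_integral \<Omega> v (z i)"
        using choquet_integral_ge_lower_sum[OF v sa level[OF i] zK[OF i]] \<mu>'(4) by simp
    qed
    also have "\<dots> = real N * ?S"
      unfolding z_def using N by (simp add: choquet_integral_pos_homogeneous sum_distrib_left)
    finally show ?thesis using \<mu>'(4) by simp
  qed
  show ?thesis
  proof (rule ccontr)
    assume "\<not> 0 \<le> ?S"
    then have "0 < - ?S" by simp
    then obtain N where N: "real (card I) * v \<Omega> < real N * - ?S"
      using ex_less_of_nat_mult by blast
    \<comment> \<open>Non-negative total mass excludes N = 0, where \<open>scaled\<close> says
      nothing.\<close>
    have "0 \<le> v \<Omega>" using \<mu>'(2,4) top by metis
    then have "0 < N" using N by (cases N) (auto simp: mult_less_0_iff)
    then show False using scaled[of N] N by simp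
  qed
qed

lemma arbitrage_free_if_anticore_nonempty:
  assumes sa: "sigma_algebra \<Omega> \<A>" and v: "capacity \<A> v"
    and f: "choquet_pricing_rule \<Omega> \<A> v f" and ac: "anticore \<Omega> \<A> v \<noteq> {}"
  shows "arbitrage_free \<Omega> \<A> f"
  unfolding arbitrage_free_def
proof (intro allI impI)
  fix n :: nat and x :: "nat \<Rightarrow> 'a \<Rightarrow> real"
  assume x: "\<forall>i \<in> {1..n}. x i \<in> bounded_measurable \<Omega> \<A>"
    and pos: "\<forall>\<omega> \<in> \<Omega>. 0 \<le> (\<Sum>i = 1..n. x i \<omega>)"
  have "0 \<le> (\<Sum>i = 1..n. choquet_integral \<Omega> v (x i))"
    using ac x pos sum_choquet_integral_nonneg[OF sa v, of _ "{1..n}" x] by blast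
  then show "0 \<le> (\<Sum>i = 1..n. f (x i))"
    using f x unfolding choquet_pricing_rule_def by simp
qed

section \<open>The Sipos integral\<close>

lemma sipos_integral_neg: "sipos_integral \<Omega> v (\<lambda>\<omega>. - x \<omega>) = - sipos_integral \<Omega> v x"
  by (simp add: sipos_integral_def)

text \<open>Non-negative factors pass through positive and negative parts; negative factors reduce
  to these by oddness of the integral.\<close>

lemma sipos_integral_homogeneous:
  assumes "v {} = 0"
  shows "sipos_integral \<Omega> v (\<lambda>\<omega>. c * x \<omega>) = c * sipos_integral \<Omega> v x"
proof -
  have *: "sipos_integral \<Omega> v (\<lambda>\<omega>. c * x \<omega>) = c * sipos_integral \<Omega> v x" if "0 \<le> c" for c x
  proof -
    have "max (c * x \<omega>) 0 = c * max (x \<omega>) 0" "max (- (c * x \<omega>)) 0 = c * max (- x \<omega>) 0" for \<omega>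
      using that by (auto simp: max_def mult_le_0_iff zero_le_mult_iff)
    then show ?thesis
      using that assms by (simp add: sipos_integral_def choquet_integral_homogeneous algebra_simps)
  qed
  show ?thesis
  proof (cases "0 \<le> c")
    case False
    then show ?thesis
      using *[of "- c" "\<lambda>\<omega>. - x \<omega>"] by (simp add: sipos_integral_neg)
  qed (rule *)
qed

lemma sipos_integral_nonneg:
  assumes "capacity \<A> v" "sigma_algebra \<Omega> \<A>" "x \<in> bounded_measurable \<Omega> \<A>"
    and "\<And>\<omega>. \<omega> \<in> \<Omega> \<Longrightarrow> 0 \<le> x \<omega>"
  shows "0 \<le> sipos_integral \<Omega> v x"
proof -
  \<comment> \<open>The negative part vanishes on \<Omega>, and the positive part is
    \<open>x\<close> there.\<close>
  have "sipos_integral \<Omega> v x = choquet_integral \<Omega> v x - choquet_integral \<Omega> v (\<lambda>\<omega>. 0)"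
    unfolding sipos_integral_def using assms(4)
    by (intro arg_cong2[where f = "(-)"] choquet_integral_cong) auto
  also have "\<dots> = choquet_integral \<Omega> v x"
    using assms(1) by (simp add: choquet_integral_zero capacity_def)
  finally show ?thesis
    using choquet_integral_nonneg[OF assms(1,2) bounded_measurable_level_set[OF assms(2,3)] assms(4)]
    by simp
qed

text \<open>Linearity makes the total price of a family the price of its sum, so arbitrage freeness
  reduces to positivity.\<close>

lemma arbitrage_free_if_linear_rule:
  assumes lin: "linear_rule \<Omega> \<A> f"
    and pos: "\<And>x. x \<in> bounded_measurable \<Omega> \<A> \<Longrightarrow> (\<And>\<omega>. \<omega> \<in> \<Omega> \<Longrightarrow> 0 \<le> x \<omega>) \<Longrightarrow> 0 \<le> f x"
  shows "arbitrage_free \<Omega> \<A> f"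
  unfolding arbitrage_free_def
proof (intro allI impI)
  let ?B = "bounded_measurable \<Omega> \<A>"
  fix n :: nat and x :: "nat \<Rightarrow> 'a \<Rightarrow> real"
  assume x: "\<forall>i \<in> {1..n}. x i \<in> ?B" and sum: "\<forall>\<omega> \<in> \<Omega>. 0 \<le> (\<Sum>i = 1..n. x i \<omega>)"
  have add: "f (\<lambda>\<omega>. x \<omega> + y \<omega>) = f x + f y" if "x \<in> ?B" "y \<in> ?B" for x y
    using lin[unfolded linear_rule_def, rule_format, OF that, of 1 1] by simp
  have zero: "f (\<lambda>\<omega>. 0) = 0"
    using add[OF bounded_measurable_zero bounded_measurable_zero] by simp
  \<comment> \<open>Membership of the partial sums is carried through the induction because
    additivity at the next step requires it.\<close>
  have "(\<lambda>\<omega>. \<Sum>i = 1..n. x i \<omega>) \<in> ?B \<and> f (\<lambda>\<omega>. \<Sum>i = 1..n. x i \<omega>) = (\<Sum>i = 1..n. f (x i))"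
    using x
  proof (induction n)
    case 0
    then show ?case using bounded_measurable_zero zero by simp
  next
    case (Suc n)
    then show ?case
      using add[of "\<lambda>\<omega>. \<Sum>i = 1..n. x i \<omega>" "x (Suc n)"]
        bounded_measurable_add[of "\<lambda>\<omega>. \<Sum>i = 1..n. x i \<omega>" \<Omega> \<A> "x (Suc n)"] by simp
  qed
  then show "0 \<le> (\<Sum>i = 1..n. f (x i))"
    using pos[of "\<lambda>\<omega>. \<Sum>i = 1..n. x i \<omega>"] sum by simp
qed

lemma sipos_linear_rule_if_arbitrage_free:
  assumes v: "capacity \<A> v"
    and f: "\<And>x. x \<in> bounded_measurable \<Omega> \<A> \<Longrightarrow> f x = sipos_integral \<Omega> v x"
    and af: "arbitrage_free \<Omega> \<A> f"
  shows "linear_rule \<Omega> \<A> f"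
proof -
  let ?B = "bounded_measurable \<Omega> \<A>"
  have neg: "f (\<lambda>\<omega>. - x \<omega>) = - f x" if "x \<in> ?B" for x
    using that by (simp add: f bounded_measurable_neg sipos_integral_neg)
  have hom: "f (\<lambda>\<omega>. c * x \<omega>) = c * f x" if "x \<in> ?B" for x c
    using that v unfolding capacity_def
    by (simp add: f bounded_measurable_scale sipos_integral_homogeneous)
  have sub: "f (\<lambda>\<omega>. x \<omega> + y \<omega>) \<le> f x + f y" if xy: "x \<in> ?B" "y \<in> ?B" for x y
  proof -
    have z: "(\<lambda>\<omega>. x \<omega> + y \<omega>) \<in> ?B" using xy by (rule bounded_measurable_add)
    \<comment> \<open>The three claims cancel, and oddness turns the price of the third into minus
      the price of x + y.\<close>
    have "0 \<le> (\<Sum>w\<leftarrow>[x, y, \<lambda>\<omega>. - (x \<omega> + y \<omega>)]. f w)"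
      by (rule arbitrage_free_list[OF af]) (use xy bounded_measurable_neg[OF z] in auto)
    then show ?thesis using neg[OF z] by simp
  qed
  have add: "f (\<lambda>\<omega>. x \<omega> + y \<omega>) = f x + f y" if xy: "x \<in> ?B" "y \<in> ?B" for x y
  proof (rule antisym[OF sub[OF xy]])
    \<comment> \<open>Subadditivity at - x and - y, read through oddness, is superadditivity at
      \<open>x\<close> and \<open>y\<close>.\<close>
    have "f (\<lambda>\<omega>. - (x \<omega> + y \<omega>)) \<le> f (\<lambda>\<omega>. - x \<omega>) + f (\<lambda>\<omega>. - y \<omega>)"
      using sub[OF bounded_measurable_neg[OF xy(1)] bounded_measurable_neg[OF xy(2)]] by simp
    then show "f x + f y \<le> f (\<lambda>\<omega>. x \<omega> + y \<omega>)"
      using neg[OF xy(1)] neg[OF xy(2)] neg[OF bounded_measurable_add[OF xy]] by simp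
  qed
  show ?thesis
    unfolding linear_rule_def
    using add[OF bounded_measurable_scale bounded_measurable_scale] hom by simp
qed

section \<open>The equivalences for Choquet and Sipos pricing rules\<close>

theorem theorem5:
  fixes \<Omega> :: "'a set" and \<A> :: "'a set set" and f :: "('a \<Rightarrow> real) \<Rightarrow> real"
  assumes "sigma_algebra \<Omega> \<A>"
    and "pricing_rule \<Omega> \<A> f"
  shows "(\<forall>v. capacity \<A> v \<longrightarrow> choquet_pricing_rule \<Omega> \<A> v f \<longrightarrow>
            (arbitrage_free \<Omega> \<A> f \<longleftrightarrow> anticore \<Omega> \<A> v \<noteq> {})) \<and>
         (sipos_pricing_rule \<Omega> \<A> f \<longrightarrow>
            (arbitrage_free \<Omega> \<A> f \<longleftrightarrow> linear_rule \<Omega> \<A> f))"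
proof (intro conjI allI impI)
  fix v assume "capacity \<A> v" "choquet_pricing_rule \<Omega> \<A> v f"
  then show "arbitrage_free \<Omega> \<A> f \<longleftrightarrow> anticore \<Omega> \<A> v \<noteq> {}"
    using anticore_nonempty_if_arbitrage_free[OF assms(1)]
      arbitrage_free_if_anticore_nonempty[OF assms(1)] by blast
next
  assume "sipos_pricing_rule \<Omega> \<A> f"
  then obtain v where v: "capacity \<A> v"
    and f: "\<And>x. x \<in> bounded_measurable \<Omega> \<A> \<Longrightarrow> f x = sipos_integral \<Omega> v x"
    unfolding sipos_pricing_rule_def by blast
  show "arbitrage_free \<Omega> \<A> f \<longleftrightarrow> linear_rule \<Omega> \<A> f"
  proof
    show "linear_rule \<Omega> \<A> f" if "arbitrage_free \<Omega> \<A> f"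
      using v f that by (rule sipos_linear_rule_if_arbitrage_free)
    show "arbitrage_free \<Omega> \<A> f" if "linear_rule \<Omega> \<A> f"
      using that
    proof (rule arbitrage_free_if_linear_rule)
      fix x assume "x \<in> bounded_measurable \<Omega> \<A>" "\<And>\<omega>. \<omega> \<in> \<Omega> \<Longrightarrow> 0 \<le> x \<omega>"
      then show "0 \<le> f x"
        using sipos_integral_nonneg[OF v assms(1)] f by simp
    qed
  qed
qed

end
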